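(* Let $G=(V,E)$ be a graph with $V=\{1,\dots,N\}$, let $k\ge1$ and $\epsilon\in[0,1)$, and suppose $\rho$ is an $(\epsilon,k)$-partitioning of $G$. Then for every finite alphabet $\mathcal{X}$, non-negative potentials $(\phi_e)_{e\in E}$ and $\theta\in\mathbb{R}_+^E$, $$\sqrt{1-\epsilon}\le\frac{\Phi(\theta)}{\widehat\Phi_\rho(\theta)}\le\frac{1}{\sqrt{1-\epsilon}}.$$
   Context: Problem: a finite alphabet $\mathcal{X}$, potentials $\phi_e:\mathcal{X}\times\mathcal{X}\to\mathbb{R}_+$ for $e=(s,t)\in E$, weights $\theta\in\mathbb{R}_+^E$, and $\Phi(\theta)=\log\sum_{x\in\mathcal{X}^N}\exp\big(\sum_{e\in E}\theta_e\phi_e(x_s,x_t)\big)$. $\mathrm{Part}_k(G)$ is the set of subgraphs $H=(V,\bigcup_i E(S_i))$ where $(S_i)_i$ is a partition of $V$ with $|S_i|\le k$ for all $i$, and $E(S)=E\cap(S\times S)$. A probability distribution $\rho$ on $\mathrm{Part}_k(G)$ is an $(\epsilon,k)$-partitioning of $G$ if $\rho_e:=\mathbb{P}_{H\sim\rho}(e\in H)$ satisfies $1-\epsilon\le\rho_e\le1$ for all $e\in E$. For a subgraph $H$ (identified with its edge set), $\Pi^H(\theta)=(\mathbf 1(e\in H)\theta_e)_e$ and $\Pi^H_\rho(\theta)=(\mathbf 1(e\in H)\theta_e/\rho_e)_e$; $L_\rho(\theta)=\mathbb{E}_{H\sim\rho}\Phi(\Pi^H(\theta))$, $U_\rho(\theta)=\mathbb{E}_{H\sim\rho}\Phi(\Pi^H_\rho(\theta))$,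 $\widehat\Phi_\rho(\theta)=\sqrt{L_\rho(\theta)U_\rho(\theta)}$. *)

theory Defs
  imports "HOL-Probability.Probability"
begin

text \<open>
  A graph is a vertex set \<open>V\<close> together with a set \<open>E \<subseteq> V \<times> V\<close> of pairs \<open>(s, t)\<close>; an undirected
  edge is represented by the pair that fixes the order in which the potential \<open>\<phi> (s, t)\<close> takes
  its two arguments. Nothing below depends on which orientation is chosen, and loops or pairs
  of opposite edges are not excluded.
\<close>

type_synonym edge = "nat \<times> nat"

definition induced_edges :: "edge set \<Rightarrow> nat set \<Rightarrow> edge set" where
  "induced_edges E S = E \<inter> S \<times> S"

text \<open>
  All subgraphs in question have the full vertex set \<open>V\<close>, so they are identified with their
  edge sets. Different partitions may yield the same subgraph.
\<close>

definition Part :: "nat \<Rightarrow> nat set \<Rightarrow> edge set \<Rightarrow> edge set set" where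
  "Part k V E =
     {(\<Union>S\<in>P. induced_edges E S) | P. partition_on V P \<and> (\<forall>S\<in>P. card S \<le> k)}"

definition edge_prob :: "edge set pmf \<Rightarrow> edge \<Rightarrow> real" where
  "edge_prob \<rho> e = measure_pmf.prob \<rho> {H. e \<in> H}"

definition is_partitioning ::
    "real \<Rightarrow> nat \<Rightarrow> nat set \<Rightarrow> edge set \<Rightarrow> edge set pmf \<Rightarrow> bool" where
  "is_partitioning \<epsilon> k V E \<rho> \<longleftrightarrow>
     set_pmf \<rho> \<subseteq> Part k V E \<and>
     (\<forall>e\<in>E. 1 - \<epsilon> \<le> edge_prob \<rho> e \<and> edge_prob \<rho> e \<le> 1)"

text \<open>
  \<open>X\<close> is the alphabet; the extensional function space \<open>V \<rightarrow>\<^sub>E X\<close> contains exactly one function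
  for each configuration in \<open>X\<close> to the power \<open>V\<close>. Only the values of \<open>\<theta>\<close> and \<open>\<phi>\<close> at
  the edges in \<open>E\<close> matter.
\<close>

definition log_partition ::
    "nat set \<Rightarrow> edge set \<Rightarrow> 'a set \<Rightarrow> (edge \<Rightarrow> 'a \<times> 'a \<Rightarrow> real) \<Rightarrow> (edge \<Rightarrow> real) \<Rightarrow> real" where
  "log_partition V E X \<phi> \<theta> =
     ln (\<Sum>x\<in>V \<rightarrow>\<^sub>E X. exp (\<Sum>(s, t)\<in>E. \<theta> (s, t) * \<phi> (s, t) (x s, x t)))"

definition proj :: "edge set \<Rightarrow> (edge \<Rightarrow> real) \<Rightarrow> edge \<Rightarrow> real" where
  "proj H \<theta> = (\<lambda>e. of_bool (e \<in> H) * \<theta> e)"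

definition proj_scaled :: "edge set pmf \<Rightarrow> edge set \<Rightarrow> (edge \<Rightarrow> real) \<Rightarrow> edge \<Rightarrow> real" where
  "proj_scaled \<rho> H \<theta> = (\<lambda>e. of_bool (e \<in> H) * \<theta> e / edge_prob \<rho> e)"

definition L_bound ::
    "nat set \<Rightarrow> edge set \<Rightarrow> 'a set \<Rightarrow> (edge \<Rightarrow> 'a \<times> 'a \<Rightarrow> real) \<Rightarrow> edge set pmf \<Rightarrow>
     (edge \<Rightarrow> real) \<Rightarrow> real" where
  "L_bound V E X \<phi> \<rho> \<theta> =
     measure_pmf.expectation \<rho> (\<lambda>H. log_partition V E X \<phi> (proj H \<theta>))"

definition U_bound ::
    "nat set \<Rightarrow> edge set \<Rightarrow> 'a set \<Rightarrow> (edge \<Rightarrow> 'a \<times> 'a \<Rightarrow> real) \<Rightarrow> edge set pmf \<Rightarrow>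
     (edge \<Rightarrow> real) \<Rightarrow> real" where
  "U_bound V E X \<phi> \<rho> \<theta> =
     measure_pmf.expectation \<rho> (\<lambda>H. log_partition V E X \<phi> (proj_scaled \<rho> H \<theta>))"

definition log_partition_est ::
    "nat set \<Rightarrow> edge set \<Rightarrow> 'a set \<Rightarrow> (edge \<Rightarrow> 'a \<times> 'a \<Rightarrow> real) \<Rightarrow> edge set pmf \<Rightarrow>
     (edge \<Rightarrow> real) \<Rightarrow> real" where
  "log_partition_est V E X \<phi> \<rho> \<theta> = sqrt (L_bound V E X \<phi> \<rho> \<theta> * U_bound V E X \<phi> \<rho> \<theta>)"

end

theory Submission
  imports Defs
begin

text \<open>
  The theorem combines three inequalities: \<open>L \<le> \<Phi> \<le> U\<close> and \<open>(1 - \<epsilon>) U \<le> L\<close>. The first is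
  monotonicity of \<open>\<Phi>\<close>. The second is Jensen's inequality for the convex function \<open>\<Phi>\<close>, since
  \<open>\<theta>\<close> is the mean of its rescaled projections. For the third, \<open>1 - \<epsilon> \<le> \<rho>\<^sub>e\<close> shows that the
  projection dominates \<open>1 - \<epsilon>\<close> times the rescaled projection, and \<open>c \<Phi>(\<eta>) \<le> \<Phi>(c \<eta>)\<close> for
  \<open>0 \<le> c \<le> 1\<close> because a sum of \<open>c\<close>-th powers dominates the \<open>c\<close>-th power of the sum.
\<close>

section \<open>Log-sum-exp over a finite set: monotonicity, scaling and convexity\<close>

definition log_sum_exp :: "'b set \<Rightarrow> ('b \<Rightarrow> real) \<Rightarrow> real" where
  "log_sum_exp A f = ln (\<Sum>x\<in>A. exp (f x))"

lemma exp_log_sum_exp: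
  assumes "finite A" "A \<noteq> {}"
  shows "exp (log_sum_exp A f) = (\<Sum>x\<in>A. exp (f x))"
  unfolding log_sum_exp_def using assms by (intro exp_ln sum_pos) auto

lemma log_sum_exp_geI:
  assumes "finite A" "A \<noteq> {}" "exp c \<le> (\<Sum>x\<in>A. exp (f x))"
  shows "c \<le> log_sum_exp A f"
  using assms exp_log_sum_exp by (metis exp_le_cancel_iff)

lemma log_sum_exp_mono:
  assumes "finite A" "A \<noteq> {}" "\<And>x. x \<in> A \<Longrightarrow> f x \<le> g x"
  shows "log_sum_exp A f \<le> log_sum_exp A g"
  by (rule log_sum_exp_geI[OF assms(1,2)])
    (auto simp: exp_log_sum_exp assms intro!: sum_mono)

lemma member_le_log_sum_exp:
  assumes "finite A" "x \<in> A"
  shows "f x \<le> log_sum_exp A f"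
  using assms by (intro log_sum_exp_geI member_le_sum) auto

text \<open>These are the Gibbs weights of \<open>f\<close>, the gradient of log-sum-exp at
  \<open>f\<close>; the scaling and tangent bounds both rest on their normalisation.\<close>

lemma sum_softmax:
  assumes "finite A" "A \<noteq> {}"
  shows "(\<Sum>x\<in>A. exp (f x - log_sum_exp A f)) = 1"
  by (simp add: exp_diff exp_log_sum_exp[OF assms, symmetric] flip: sum_divide_distrib)

text \<open>Each Gibbs weight lies in [0,1], so its \<open>c\<close>-th power is no smaller. The
  powers thus sum to at least 1, and clearing the normalising factor gives the claim.\<close>

lemma log_sum_exp_scale:
  assumes "finite A" "A \<noteq> {}" "0 \<le> c" "c \<le> 1"
  shows "c * log_sum_exp A f \<le> log_sum_exp A (\<lambda>x. c * f x)"
proof (rule log_sum_exp_geI[OF assms(1,2)])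
  let ?l = "log_sum_exp A f"
  have "1 = (\<Sum>x\<in>A. exp (f x - ?l))"
    using assms by (simp add: sum_softmax)
  also have "\<dots> \<le> (\<Sum>x\<in>A. exp (c * (f x - ?l)))"
  proof (intro sum_mono)
    fix x assume "x \<in> A"
    then have "f x - ?l \<le> 0"
      using member_le_log_sum_exp[OF assms(1)] by (simp add: le_diff_eq)
    then have "1 * (f x - ?l) \<le> c * (f x - ?l)"
      using assms(4) by (rule mult_right_mono_neg[rotated])
    then show "exp (f x - ?l) \<le> exp (c * (f x - ?l))"
      by simp
  qed
  also have "\<dots> = (\<Sum>x\<in>A. exp (c * f x)) / exp (c * ?l)"
    by (simp add: right_diff_distrib exp_diff sum_divide_distrib)
  finally show "exp (c * ?l) \<le> (\<Sum>x\<in>A. exp (c * f x))"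
    by simp
qed

text \<open>First-order form of convexity: the graph lies above its tangent at \<open>f\<close>.
  After exponentiating, it is \<open>1 + t \<le> exp t\<close> averaged under the Gibbs weights of
  \<open>f\<close>.\<close>

lemma log_sum_exp_gradient:
  assumes "finite A" "A \<noteq> {}"
  shows "log_sum_exp A f + (\<Sum>x\<in>A. exp (f x - log_sum_exp A f) * (g x - f x)) \<le> log_sum_exp A g"
proof (rule log_sum_exp_geI[OF assms])
  define p where "p x = exp (f x - log_sum_exp A f)" for x
  define m where "m = (\<Sum>x\<in>A. p x * (g x - f x))"
  have p1: "sum p A = 1"
    using sum_softmax[OF assms, of f] by (simp add: p_def)
  \<comment> \<open>Centring \<open>g - f\<close> at its weighted mean \<open>m\<close> makes the
    linear term vanish once \<open>sum p A = 1\<close> is inserted.\<close>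
  have "(\<Sum>x\<in>A. p x * (1 + (g x - f x - m))) = sum p A + m - sum p A * m"
    unfolding m_def[symmetric] sum_distrib_right
    by (simp add: m_def distrib_left right_diff_distrib sum.distrib sum_subtractf)
  then have "1 = (\<Sum>x\<in>A. p x * (1 + (g x - f x - m)))"
    using p1 by simp
  also have "\<dots> \<le> (\<Sum>x\<in>A. p x * exp (g x - f x - m))"
    by (intro sum_mono mult_left_mono exp_ge_add_one_self) (simp add: p_def)
  also have "\<dots> = (\<Sum>x\<in>A. exp (g x)) / exp (log_sum_exp A f + m)"
    by (simp add: p_def sum_divide_distrib flip: exp_add exp_diff)
      (simp add: algebra_simps)
  finally show "exp (log_sum_exp A f + (\<Sum>x\<in>A. exp (f x - log_sum_exp A f) * (g x - f x)))
      \<le> (\<Sum>x\<in>A. exp (g x))"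
    by (simp add: m_def p_def)
qed

text \<open>Jensen's inequality: average the tangent at the mean \<open>f\<close>; its linear term
  has expectation zero by \<open>mean\<close>.\<close>

lemma log_sum_exp_expectation:
  fixes g :: "'c \<Rightarrow> 'b \<Rightarrow> real"
  assumes "finite A" "A \<noteq> {}" "finite (set_pmf \<rho>)"
    and mean: "\<And>x. x \<in> A \<Longrightarrow> measure_pmf.expectation \<rho> (\<lambda>h. g h x) = f x"
  shows "log_sum_exp A f \<le> measure_pmf.expectation \<rho> (\<lambda>h. log_sum_exp A (g h))"
proof -
  have int: "integrable (measure_pmf \<rho>) u" for u :: "'c \<Rightarrow> real"
    using assms(3) by (rule integrable_measure_pmf_finite)
  let ?p = "\<lambda>x. exp (f x - log_sum_exp A f)"
  have "log_sum_exp A f =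
      measure_pmf.expectation \<rho> (\<lambda>h. log_sum_exp A f + (\<Sum>x\<in>A. ?p x * (g h x - f x)))"
    by (simp add: int mean)
  also have "\<dots> \<le> measure_pmf.expectation \<rho> (\<lambda>h. log_sum_exp A (g h))"
    by (intro integral_mono int log_sum_exp_gradient assms)
  finally show ?thesis .
qed

section \<open>Energies of configurations and random edge sets\<close>

definition energy :: "edge set \<Rightarrow> (edge \<Rightarrow> 'a \<times> 'a \<Rightarrow> real) \<Rightarrow> (edge \<Rightarrow> real) \<Rightarrow> (nat \<Rightarrow> 'a) \<Rightarrow> real" where
  "energy E \<phi> \<theta> x = (\<Sum>e\<in>E. \<theta> e * \<phi> e (x (fst e), x (snd e)))"

text \<open>The energy is linear in the weights, so scaling and averaging of weights become
  operations on vectors indexed by configurations.\<close>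

lemma log_partition_eq: "log_partition V E X \<phi> \<theta> = log_sum_exp (V \<rightarrow>\<^sub>E X) (energy E \<phi> \<theta>)"
  unfolding log_partition_def log_sum_exp_def energy_def by (simp add: case_prod_beta')

lemma energy_scale: "energy E \<phi> (\<lambda>e. c * \<theta> e) x = c * energy E \<phi> \<theta> x"
  by (simp add: energy_def sum_distrib_left mult.assoc)

text \<open>Inverse-probability weighting: dividing by \<open>edge_prob \<rho> e\<close> compensates
  for the chance that \<open>e\<close> is cut.\<close>

lemma expectation_proj_scaled:
  assumes "edge_prob \<rho> e \<noteq> 0"
  shows "measure_pmf.expectation \<rho> (\<lambda>H. proj_scaled \<rho> H \<theta> e) = \<theta> e"
proof -
  have "proj_scaled \<rho> H \<theta> e = indicator {H. e \<in> H} H * (\<theta> e / edge_prob \<rho> e)" for H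
    by (simp add: proj_scaled_def indicator_def)
  then show ?thesis
    using assms by (simp add: edge_prob_def)
qed

text \<open>Makes the support of a partitioning finite when \<open>E\<close> is, so that
  integrability is automatic.\<close>

lemma Part_subset_Pow: "Part k V E \<subseteq> Pow E"
  by (auto simp: Part_def induced_edges_def)

section \<open>Comparison of \<open>L_bound\<close> and \<open>U_bound\<close> with the
  log-partition function\<close>

locale weighted_edge_model =
  fixes V :: "nat set" and E :: "edge set" and X :: "'a set"
    and \<phi> :: "edge \<Rightarrow> 'a \<times> 'a \<Rightarrow> real" and \<theta> :: "edge \<Rightarrow> real" and \<rho> :: "edge set pmf"
  assumes fin_V: "finite V" and E_V: "E \<subseteq> V \<times> V"
    and fin_X: "finite X" and X_ne: "X \<noteq> {}"
    and phi_nonneg: "\<And>e a b. e \<in> E \<Longrightarrow> a \<in> X \<Longrightarrow> b \<in> X \<Longrightarrow> 0 \<le> \<phi> e (a, b)"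
    and theta_nonneg: "\<And>e. e \<in> E \<Longrightarrow> 0 \<le> \<theta> e"
    and fin_supp: "finite (set_pmf \<rho>)"
begin

lemma configurations: "finite (V \<rightarrow>\<^sub>E X)" "V \<rightarrow>\<^sub>E X \<noteq> {}"
  using fin_V fin_X X_ne by (auto simp: finite_PiE PiE_eq_empty_iff)

lemma integrable_pmf: "integrable (measure_pmf \<rho>) (u :: edge set \<Rightarrow> real)"
  using fin_supp by (rule integrable_measure_pmf_finite)

lemma energy_mono:
  assumes "x \<in> V \<rightarrow>\<^sub>E X" and le: "\<And>e. e \<in> E \<Longrightarrow> \<eta> e \<le> \<eta>' e"
  shows "energy E \<phi> \<eta> x \<le> energy E \<phi> \<eta>' x"
  unfolding energy_def
proof (intro sum_mono mult_right_mono)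
  fix e assume "e \<in> E"
  then show "0 \<le> \<phi> e (x (fst e), x (snd e))"
    using assms(1) E_V by (cases e) (auto intro!: phi_nonneg dest: PiE_mem)
qed (use le in auto)

lemma log_partition_mono:
  assumes "\<And>e. e \<in> E \<Longrightarrow> \<eta> e \<le> \<eta>' e"
  shows "log_partition V E X \<phi> \<eta> \<le> log_partition V E X \<phi> \<eta>'"
  unfolding log_partition_eq
  using configurations assms by (intro log_sum_exp_mono energy_mono)

text \<open>A single configuration already contributes the exponential of a non-negative energy,
  hence at least 1.\<close>

lemma log_partition_nonneg: "0 \<le> log_partition V E X \<phi> \<theta>"
proof -
  obtain x where x: "x \<in> V \<rightarrow>\<^sub>E X"
    using configurations(2) by blast
  have "0 = energy E \<phi> (\<lambda>_. 0) x"
    by (simp add: energy_def)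
  also have "\<dots> \<le> energy E \<phi> \<theta> x"
    using x theta_nonneg by (rule energy_mono)
  also have "\<dots> \<le> log_partition V E X \<phi> \<theta>"
    unfolding log_partition_eq using configurations(1) x by (rule member_le_log_sum_exp)
  finally show ?thesis .
qed

lemma L_bound_le: "L_bound V E X \<phi> \<rho> \<theta> \<le> log_partition V E X \<phi> \<theta>"
proof -
  have "L_bound V E X \<phi> \<rho> \<theta> \<le> measure_pmf.expectation \<rho> (\<lambda>_. log_partition V E X \<phi> \<theta>)"
    unfolding L_bound_def
    by (intro integral_mono integrable_pmf log_partition_mono) (simp add: proj_def theta_nonneg)
  then show ?thesis by simp
qed

lemma le_U_bound:
  assumes "\<And>e. e \<in> E \<Longrightarrow> edge_prob \<rho> e \<noteq> 0"
  shows "log_partition V E X \<phi> \<theta> \<le> U_bound V E X \<phi> \<rho> \<theta>"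
  unfolding U_bound_def log_partition_eq
proof (rule log_sum_exp_expectation[OF configurations fin_supp])
  \<comment> \<open>Jensen is applied to energies, not to weights; linearity reduces the mean to one
    edge at a time.\<close>
  show "measure_pmf.expectation \<rho> (\<lambda>H. energy E \<phi> (proj_scaled \<rho> H \<theta>) x) = energy E \<phi> \<theta> x" for x
    using assms by (simp add: energy_def integrable_pmf expectation_proj_scaled)
qed

lemma scaled_U_bound_le_L_bound:
  assumes "0 \<le> c" "c \<le> 1" and "\<And>e. e \<in> E \<Longrightarrow> c \<le> edge_prob \<rho> e"
  shows "c * U_bound V E X \<phi> \<rho> \<theta> \<le> L_bound V E X \<phi> \<rho> \<theta>"
proof -
  have "c * log_partition V E X \<phi> (proj_scaled \<rho> H \<theta>) \<le> log_partition V E X \<phi> (proj H \<theta>)" for H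
  proof -
    have "c * log_partition V E X \<phi> (proj_scaled \<rho> H \<theta>)
        \<le> log_partition V E X \<phi> (\<lambda>e. c * proj_scaled \<rho> H \<theta> e)"
      unfolding log_partition_eq energy_scale
      using configurations assms(1,2) by (rule log_sum_exp_scale)
    also have "\<dots> \<le> log_partition V E X \<phi> (proj H \<theta>)"
    proof (rule log_partition_mono)
      fix e assume "e \<in> E"
      \<comment> \<open>This is the claim for edges in \<open>H\<close>; for the others both sides
        are 0. If the probability is 0 then so is \<open>c\<close>, and the quotient is 0 by
        convention.\<close>
      then have "c / edge_prob \<rho> e * \<theta> e \<le> 1 * \<theta> e"
        using assms theta_nonneg by (intro mult_right_mono) (auto simp: divide_le_eq_1)
      then show "c * proj_scaled \<rho> H \<theta> e \<le> proj H \<theta> e"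
        by (auto simp: proj_scaled_def proj_def)
    qed
    finally show ?thesis .
  qed
  then have "measure_pmf.expectation \<rho> (\<lambda>H. c * log_partition V E X \<phi> (proj_scaled \<rho> H \<theta>))
      \<le> L_bound V E X \<phi> \<rho> \<theta>"
    unfolding L_bound_def by (intro integral_mono integrable_pmf)
  then show ?thesis
    by (simp add: U_bound_def)
qed

end

text \<open>Both \<open>l\<close> and \<open>c * u\<close> are at most \<open>a\<close>, so
  \<open>c * (l * u) \<le> a * a\<close>; conversely
  \<open>c * (a * a) \<le> (c * u) * u \<le> l * u\<close>. Square roots give the two
  halves.\<close>

lemma geometric_mean_ratio_bounds:
  fixes a l u c :: real
  assumes "0 \<le> a" "l \<le> a" "a \<le> u" "c * u \<le> l" "0 < c"
  shows "(sqrt (l * u) \<noteq> 0 \<longrightarrow> sqrt c \<le> a / sqrt (l * u) \<and> a / sqrt (l * u) \<le> 1 / sqrt c) \<and>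
         (sqrt (l * u) = 0 \<longrightarrow> a = 0)"
proof -
  have u: "0 \<le> u" using assms by linarith
  have l: "0 \<le> l" using assms u by (meson mult_nonneg_nonneg less_imp_le order_trans)
  have "c * (l * u) = l * (c * u)" by simp
  also have "\<dots> \<le> a * a" using assms l u by (intro mult_mono) auto
  finally have lower: "sqrt c * sqrt (l * u) \<le> a"
    using assms(1) by (simp add: real_le_lsqrt power2_eq_square flip: real_sqrt_mult)
  have "c * (a * a) \<le> c * (u * u)" using assms u by (intro mult_left_mono mult_mono) auto
  also have "\<dots> = (c * u) * u" by simp
  also have "\<dots> \<le> l * u" using assms(4) u by (rule mult_right_mono)
  finally have "sqrt (c * (a * a)) \<le> sqrt (l * u)" by simp
  then have upper: "sqrt c * a \<le> sqrt (l * u)" using assms(1) by (simp add: real_sqrt_mult)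
  have c: "0 < sqrt c" using assms(5) by simp
  show ?thesis
  proof (intro conjI impI)
    assume "sqrt (l * u) = 0"
    \<comment> \<open>The division-free bound survives the degenerate case and squeezes
      \<open>a\<close> to 0.\<close>
    with upper have "sqrt c * a \<le> 0" by metis
    then show "a = 0" using c assms(1) by (simp add: mult_le_0_iff)
  next
    assume "sqrt (l * u) \<noteq> 0"
    then have "0 < sqrt (l * u)" using l u by (simp add: less_le)
    then show "sqrt c \<le> a / sqrt (l * u)" "a / sqrt (l * u) \<le> 1 / sqrt c"
      using lower upper c by (simp_all add: pos_le_divide_eq pos_divide_le_eq mult.commute)
  qed
qed

(* The estimate vanishes in degenerate cases (e.g. a one-letter alphabet with all
   potentials zero). The quotient is then 0/0, and what is asserted instead is that
   the log-partition function vanishes as well, i.e. that the estimate is exact. *)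
theorem theorem8:
  fixes N k :: nat and V :: "nat set" and E :: "edge set" and \<epsilon> :: real
    and \<rho> :: "edge set pmf"
    and X :: "'a set" and \<phi> :: "edge \<Rightarrow> 'a \<times> 'a \<Rightarrow> real" and \<theta> :: "edge \<Rightarrow> real"
  assumes "V = {1..N}" and "E \<subseteq> V \<times> V"
    and "k \<ge> 1" and "0 \<le> \<epsilon>" and "\<epsilon> < 1"
    and "is_partitioning \<epsilon> k V E \<rho>"
    and "finite X" and "X \<noteq> {}"
    and "\<And>e a b. e \<in> E \<Longrightarrow> a \<in> X \<Longrightarrow> b \<in> X \<Longrightarrow> 0 \<le> \<phi> e (a, b)"
    and "\<And>e. e \<in> E \<Longrightarrow> 0 \<le> \<theta> e"
  shows "(log_partition_est V E X \<phi> \<rho> \<theta> \<noteq> 0 \<longrightarrow>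
            sqrt (1 - \<epsilon>) \<le> log_partition V E X \<phi> \<theta> / log_partition_est V E X \<phi> \<rho> \<theta> \<and>
            log_partition V E X \<phi> \<theta> / log_partition_est V E X \<phi> \<rho> \<theta> \<le> 1 / sqrt (1 - \<epsilon>)) \<and>
         (log_partition_est V E X \<phi> \<rho> \<theta> = 0 \<longrightarrow> log_partition V E X \<phi> \<theta> = 0)"
proof -
  have fin_V: "finite V" using assms(1) by simp
  then have fin_E: "finite E"
    using assms(2) by (auto intro: finite_subset)
  have prob: "1 - \<epsilon> \<le> edge_prob \<rho> e" if "e \<in> E" for e
    using assms(6) that by (simp add: is_partitioning_def)
  have "set_pmf \<rho> \<subseteq> Pow E"
    using assms(6) Part_subset_Pow unfolding is_partitioning_def by blast
  then have fin_supp: "finite (set_pmf \<rho>)"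
    using fin_E finite_subset by blast
  interpret weighted_edge_model V E X \<phi> \<theta> \<rho>
    using fin_V assms(2,7-10) fin_supp by unfold_locales
  \<comment> \<open>Since \<open>\<epsilon> < 1\<close>, no edge probability vanishes, so the
    rescaling is unbiased on every edge.\<close>
  have "edge_prob \<rho> e \<noteq> 0" if "e \<in> E" for e
    using prob[OF that] assms(5) by auto
  note le_U_bound = le_U_bound[OF this]
  \<comment> \<open>The constant \<open>c\<close> becomes \<open>1 - \<epsilon>\<close>, the lower
    bound on the edge probabilities.\<close>
  show ?thesis
    unfolding log_partition_est_def
    using assms(4,5)
    by (intro geometric_mean_ratio_bounds log_partition_nonneg L_bound_le le_U_bound
        scaled_U_bound_le_L_bound prob) simp_all
qed

end
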